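(* Let $N\ge 2$, $p\in(0,1]$, and let $\mathcal{H}_A$ have orthonormal basis $\ket{1},\ldots,\ket{N}$. For $i\in\{1,\ldots,N\}$ let $O_i$ be a unitary on $\mathcal{H}_A\otimes\mathbb{C}^2$ with $O_i\ket{i}\ket{0}=-\ket{i}\ket{1}$ and $O_i\ket{j}\ket{0}=\ket{j}\ket{1}$ for $j\neq i$, and let $\mathcal{F}_i(\rho)=p\,O_i\rho O_i^\dagger+(1-p)\rho$. Given oracle access to $\mathcal{F}_i$ for an unknown $i$, the index $i$ can be identified with probability at least $1/4$ using $\lfloor\pi/(2\theta p)\rfloor$ queries to the oracle, where $\theta=2\arcsin(1/\sqrt{N})$.
   Context: The algorithm may use a workspace, arbitrary unitaries, and calls of $\mathcal{F}_i\otimes\mathrm{Id}$, followed by a measurement whose outcome is the guess for $i$. *)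

theory Defs
  imports "Jordan_Normal_Form.Schur_Decomposition"
begin

definition mtrace :: "complex mat \<Rightarrow> complex" where
  "mtrace A = (\<Sum>k<dim_row A. A $$ (k,k))"

definition is_unitary :: "nat \<Rightarrow> complex mat \<Rightarrow> bool" where
  "is_unitary n U \<longleftrightarrow> U \<in> carrier_mat n n \<and> U * mat_adjoint U = 1\<^sub>m n \<and> mat_adjoint U * U = 1\<^sub>m n"

definition is_psd :: "nat \<Rightarrow> complex mat \<Rightarrow> bool" where
  "is_psd n M \<longleftrightarrow> M \<in> carrier_mat n n \<and>
     (\<forall>v \<in> carrier_vec n. let z = conjugate v \<bullet> (M *\<^sub>v v) in Im z = 0 \<and> Re z \<ge> 0)"

definition is_povm :: "nat \<Rightarrow> nat \<Rightarrow> (nat \<Rightarrow> complex mat) \<Rightarrow> bool" where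
  "is_povm n m M \<longleftrightarrow> (\<forall>j<m. is_psd n (M j)) \<and>
     (\<forall>r<n. \<forall>c<n. (\<Sum>j<m. M j $$ (r,c)) = (1\<^sub>m n) $$ (r,c))"

(* Standard basis: |1>,...,|N> of H_A are indices 0..N-1; on H_A \<otimes> C^2 the vector
   |j>|b> has index 2*j + b. *)

definition oracle_channel :: "real \<Rightarrow> complex mat \<Rightarrow> complex mat \<Rightarrow> complex mat" where
  "oracle_channel p Or \<rho> = complex_of_real p \<cdot>\<^sub>m (Or * \<rho> * mat_adjoint Or) + complex_of_real (1 - p) \<cdot>\<^sub>m \<rho>"

(* Phi \<otimes> Id, where Phi acts on an n-dimensional system and Id on a d-dimensional workspace;
   the joint basis index of |x>|w> is x*d + w. *)
definition tensor_id :: "nat \<Rightarrow> nat \<Rightarrow> (complex mat \<Rightarrow> complex mat) \<Rightarrow> complex mat \<Rightarrow> complex mat" where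
  "tensor_id n d \<Phi> \<sigma> =
     mat (n*d) (n*d) (\<lambda>(r,c). \<Phi> (mat n n (\<lambda>(x,y). \<sigma> $$ (x*d + r mod d, y*d + c mod d))) $$ (r div d, c div d))"

definition alg_final_state :: "nat \<Rightarrow> (complex mat \<Rightarrow> complex mat) \<Rightarrow> complex mat list \<Rightarrow> complex mat \<Rightarrow> complex mat" where
  "alg_final_state D \<Phi>' Us Uf =
     (let \<sigma> = fold (\<lambda>U \<sigma>. \<Phi>' (U * \<sigma> * mat_adjoint U)) Us (mat D D (\<lambda>(r,c). if r = 0 \<and> c = 0 then 1 else 0))
      in Uf * \<sigma> * mat_adjoint Uf)"

end

theory Submission
  imports Defs
begin

text \<open>
  A query on \<open>|a\<rangle>|0\<rangle>\<close> is heralded: with probability \<open>p\<close> it applies the Grover phase flip to \<open>a\<close> and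
  sets the qubit to \<open>1\<close>, otherwise nothing happens. Moving the qubit into the workspace records the
  outcome and supplies a fresh \<open>|0\<rangle>\<close>; conditioned on success one applies the diffusion operator.
  After \<open>T\<close> queries the number \<open>K\<close> of completed Grover iterations is binomial with parameters \<open>T\<close>
  and \<open>p\<close>, and measuring finds \<open>i\<close> with probability \<open>sin\<^sup>2 ((2 K + 1) \<theta> / 2)\<close>.

  Since \<open>sin\<^sup>2 x \<ge> 1/2 + \<pi>/8 - 2 (x - \<pi>/2)\<^sup>2 / \<pi>\<close>, the expectation is bounded through the mean and
  variance of \<open>K\<close>, which suffices for \<open>N \<ge> 13\<close>. For \<open>N \<le> 12\<close> one performs the diffusion only after
  the first success. Later successes merely flip signs of amplitudes in the measurement basis, so
  the success probability is \<open>(1 - q) (3 - 4/N)\<^sup>2 / N + q / N\<close>, where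
  \<open>q = (1 - p)\<^sup>T \<le> 1 / (1 + p T) \<le> 2/3\<close>.
\<close>

subsection \<open>Matrix entries\<close>

lemma index_mult_mat_sum:
  assumes "r < dim_row A" "c < dim_col B" "dim_col A = dim_row B"
  shows "(A * B) $$ (r, c) = (\<Sum>k<dim_row B. A $$ (r, k) * B $$ (k, c))"
  using assms by (simp add: scalar_prod_def lessThan_atLeast0)

lemma index_mult_mat_vec_sum:
  assumes "r < dim_row A" "dim_col A = dim_vec v"
  shows "(A *\<^sub>v v) $ r = (\<Sum>k<dim_vec v. A $$ (r, k) * v $ k)"
  using assms by (simp add: scalar_prod_def lessThan_atLeast0)

lemma mult_mat_unit_vec:
  fixes A :: "'a::semiring_1 mat"
  assumes "c < dim_col A"
  shows "A *\<^sub>v unit_vec (dim_col A) c = col A c"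
  using assms by (intro eq_vecI) auto

lemma mult_mat_linear:
  fixes A X Y :: "'a::comm_semiring_1 mat"
  assumes "A \<in> carrier_mat n k" "X \<in> carrier_mat k m" "Y \<in> carrier_mat k m"
  shows "A * (a \<cdot>\<^sub>m X + b \<cdot>\<^sub>m Y) = a \<cdot>\<^sub>m (A * X) + b \<cdot>\<^sub>m (A * Y)"
  using assms
  by (subst mult_add_distrib_mat[of A n k]) (auto simp: mult_smult_distrib[OF assms(1)])

lemma dim_mat_adjoint [simp]:
  "dim_row (mat_adjoint A) = dim_col A" "dim_col (mat_adjoint A) = dim_row A"
  by (auto simp: mat_adjoint_def)

lemma mat_adjoint_carrier [simp]:
  "A \<in> carrier_mat n m \<Longrightarrow> mat_adjoint A \<in> carrier_mat m n"
  by auto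

lemma index_mat_adjoint [simp]:
  assumes "r < dim_col A" "c < dim_row A"
  shows "mat_adjoint A $$ (r, c) = conjugate (A $$ (c, r))"
  using assms by (simp add: mat_adjoint_def mat_of_rows_def)

lemma is_unitaryI:
  assumes "U \<in> carrier_mat n n" "mat_adjoint U * U = 1\<^sub>m n"
  shows "is_unitary n U"
  using assms mat_mult_left_right_inverse[of "mat_adjoint U" n U] by (simp add: is_unitary_def)

lemma is_unitary_carrier: "is_unitary n U \<Longrightarrow> U \<in> carrier_mat n n"
  by (simp add: is_unitary_def)

lemma is_unitary_one: "is_unitary n (1\<^sub>m n)"
proof (rule is_unitaryI)
  have "mat_adjoint (1\<^sub>m n) = (1\<^sub>m n :: complex mat)"
    by (intro eq_matI) (auto simp: conjugate_complex_def)
  then show "mat_adjoint (1\<^sub>m n) * 1\<^sub>m n = (1\<^sub>m n :: complex mat)" by simp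
qed simp

subsection \<open>Rank-one matrices and reflections\<close>

definition outer :: "complex vec \<Rightarrow> complex mat" where
  "outer v = mat (dim_vec v) (dim_vec v) (\<lambda>(r, c). v $ r * cnj (v $ c))"

lemma outer_carrier [simp]: "v \<in> carrier_vec n \<Longrightarrow> outer v \<in> carrier_mat n n"
  by (simp add: outer_def)

lemma outer_mult_vec:
  assumes "v \<in> carrier_vec n" "w \<in> carrier_vec n"
  shows "outer v *\<^sub>v w = (w \<bullet>c v) \<cdot>\<^sub>v v"
  using assms
  by (intro eq_vecI)
     (simp_all add: outer_def scalar_prod_def conjugate_complex_def sum_distrib_left mult_ac)

text \<open>For \<open>v = 0\<close> the quotient is zero and the reflection is \<open>-1\<close>, which is still unitary.\<close>
definition reflection :: "complex vec \<Rightarrow> complex mat" where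
  "reflection v = (2 / (v \<bullet>c v)) \<cdot>\<^sub>m outer v - 1\<^sub>m (dim_vec v)"

lemma reflection_carrier [simp]: "v \<in> carrier_vec n \<Longrightarrow> reflection v \<in> carrier_mat n n"
  by (intro carrier_matI) (simp_all add: reflection_def)

lemma reflection_mult_vec:
  assumes "v \<in> carrier_vec n" "w \<in> carrier_vec n"
  shows "reflection v *\<^sub>v w = (2 * (w \<bullet>c v) / (v \<bullet>c v)) \<cdot>\<^sub>v v - w"
proof -
  have "(a \<cdot>\<^sub>m outer v) *\<^sub>v w = a \<cdot>\<^sub>v (outer v *\<^sub>v w)" for a
    using assms by (intro eq_vecI) (auto simp: outer_def)
  then have "reflection v *\<^sub>v w = (2 / (v \<bullet>c v)) \<cdot>\<^sub>v (outer v *\<^sub>v w) - w"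
    using assms by (simp add: reflection_def minus_mult_distrib_mat_vec[of _ n n])
  then show ?thesis using assms by (simp add: outer_mult_vec smult_smult_assoc)
qed

lemma mat_adjoint_reflection: "mat_adjoint (reflection v) = reflection v"
proof -
  have "cnj (v \<bullet>c v) = v \<bullet>c v"
    by (simp add: scalar_prod_def conjugate_complex_def mult.commute)
  then show ?thesis
    by (intro eq_matI) (auto simp: reflection_def outer_def conjugate_complex_def mult_ac)
qed

lemma reflection_involutive:
  assumes v: "v \<in> carrier_vec n" and w: "w \<in> carrier_vec n"
  shows "reflection v *\<^sub>v (reflection v *\<^sub>v w) = w"
proof -
  define a where "a = 2 * (w \<bullet>c v) / (v \<bullet>c v)"
  have "(a \<cdot>\<^sub>v v - w) \<bullet>c v = a * (v \<bullet>c v) - w \<bullet>c v"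
    using v w by (simp add: minus_scalar_prod_distrib[of _ n])
  moreover have "2 * (a * (v \<bullet>c v) - w \<bullet>c v) / (v \<bullet>c v) = a"
    by (cases "v \<bullet>c v = 0") (simp_all add: a_def field_simps)
  moreover have "reflection v *\<^sub>v w = a \<cdot>\<^sub>v v - w"
    using v w by (simp add: reflection_mult_vec a_def)
  ultimately have "reflection v *\<^sub>v (reflection v *\<^sub>v w) = a \<cdot>\<^sub>v v - (a \<cdot>\<^sub>v v - w)"
    using v w by (simp add: reflection_mult_vec)
  then show ?thesis using v w by auto
qed

lemma reflection_unitary:
  assumes "v \<in> carrier_vec n"
  shows "is_unitary n (reflection v)"
proof (rule is_unitaryI)
  have R: "reflection v \<in> carrier_mat n n" using assms by simp
  have "col (reflection v * reflection v) c = unit_vec n c" if "c < n" for c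
  proof -
    have "col (reflection v) c = reflection v *\<^sub>v unit_vec n c"
      using R that mult_mat_unit_vec[of c "reflection v"] by simp
    then have "col (reflection v * reflection v) c =
      reflection v *\<^sub>v (reflection v *\<^sub>v unit_vec n c)"
      using col_mult2[OF R R that] by simp
    also have "\<dots> = unit_vec n c" using assms by (intro reflection_involutive) auto
    finally show ?thesis .
  qed
  then have "reflection v * reflection v = 1\<^sub>m n"
    using R by (intro mat_col_eqI) auto
  then show "mat_adjoint (reflection v) * reflection v = 1\<^sub>m n"
    by (simp add: mat_adjoint_reflection)
qed (use assms in simp)

lemma reflection_bisector_mult_vec:
  fixes u v :: "complex vec"
  assumes u: "u \<in> carrier_vec n" and v: "v \<in> carrier_vec n"
    and "v \<bullet>c v = u \<bullet>c u" "v \<bullet>c u = u \<bullet>c v" "u \<bullet>c u + u \<bullet>c v \<noteq> 0"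
  shows "reflection (u + v) *\<^sub>v u = v"
proof -
  have sum: "w \<bullet>c (u + v) = w \<bullet>c u + w \<bullet>c v" if "w \<in> carrier_vec n" for w
    using that u v by (simp add: conjugate_add_vec[of _ n] scalar_prod_add_distrib[of _ n])
  have "(u + v) \<bullet>c (u + v) = (u \<bullet>c u + u \<bullet>c v) + (v \<bullet>c u + v \<bullet>c v)"
    using u v sum[of "u + v"] by (simp add: add_scalar_prod_distrib[of _ n])
  also have "\<dots> = 2 * (u \<bullet>c u + u \<bullet>c v)" using assms by simp
  also have "\<dots> = 2 * (u \<bullet>c (u + v))" using u sum by simp
  finally have "2 * (u \<bullet>c (u + v)) / ((u + v) \<bullet>c (u + v)) = 1"
    using assms(5) sum[OF u] by (simp del: distrib_left_numeral)
  then have "reflection (u + v) *\<^sub>v u = u + v - u"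
    using u v by (simp add: reflection_mult_vec[of _ n])
  also have "\<dots> = v" using u v by auto
  finally show ?thesis .
qed

subsection \<open>Tensor products\<close>

lemma mult_add_less_mult:
  fixes n d :: nat
  assumes "x < n" "w < d"
  shows "x * d + w < n * d"
proof -
  have "x * d + w < Suc x * d" using assms by simp
  also have "\<dots> \<le> n * d" using assms by (intro mult_le_mono1) simp
  finally show ?thesis .
qed

lemma sum_if_mod_eq:
  fixes g :: "nat \<Rightarrow> 'a::comm_monoid_add"
  assumes "w < d"
  shows "(\<Sum>k<n * d. if k mod d = w then g k else 0) = (\<Sum>x<n. g (x * d + w))"
proof -
  have "(\<Sum>k<n * d. if k mod d = w then g k else 0) = (\<Sum>k\<in>{k \<in> {..<n * d}. k mod d = w}. g k)"
    by (rule sum.inter_filter[symmetric]) simp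
  also have "\<dots> = (\<Sum>x<n. g (x * d + w))"
  proof (rule sum.reindex_bij_witness)
    fix x assume "x \<in> {..<n}"
    then show "x * d + w \<in> {k \<in> {..<n * d}. k mod d = w}" "(x * d + w) div d = x"
      using assms by (simp_all add: mult_add_less_mult)
  next
    fix k assume "k \<in> {k \<in> {..<n * d}. k mod d = w}"
    then show "k div d * d + w = k" "k div d \<in> {..<n}" "g (k div d * d + w) = g k"
      using div_mult_mod_eq[of k d] by (simp_all add: less_mult_imp_div_less)
  qed
  finally show ?thesis .
qed

definition tensor_vec :: "'a::times vec \<Rightarrow> 'a vec \<Rightarrow> 'a vec" (infixl \<open>\<otimes>\<^sub>v\<close> 75) where
  "v \<otimes>\<^sub>v w = vec (dim_vec v * dim_vec w) (\<lambda>k. v $ (k div dim_vec w) * w $ (k mod dim_vec w))"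

lemma dim_tensor_vec [simp]: "dim_vec (v \<otimes>\<^sub>v w) = dim_vec v * dim_vec w"
  by (simp add: tensor_vec_def)

lemma tensor_vec_carrier [simp]:
  "v \<in> carrier_vec n \<Longrightarrow> w \<in> carrier_vec d \<Longrightarrow> v \<otimes>\<^sub>v w \<in> carrier_vec (n * d)"
  by (intro carrier_vecI) simp

lemma index_tensor_vec [simp]:
  "k < dim_vec v * dim_vec w \<Longrightarrow> (v \<otimes>\<^sub>v w) $ k = v $ (k div dim_vec w) * w $ (k mod dim_vec w)"
  by (simp add: tensor_vec_def)

lemma tensor_vec_assoc:
  fixes u v w :: "'a::semigroup_mult vec"
  shows "u \<otimes>\<^sub>v v \<otimes>\<^sub>v w = u \<otimes>\<^sub>v (v \<otimes>\<^sub>v w)"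
proof (rule eq_vecI)
  define m d where "m = dim_vec v" and "d = dim_vec w"
  fix k assume "k < dim_vec (u \<otimes>\<^sub>v (v \<otimes>\<^sub>v w))"
  then have k: "k < dim_vec u * (m * d)" by (simp add: m_def d_def)
  then have "m * d > 0" by (intro Nat.gr0I) auto
  then have k_mod: "k mod (m * d) < m * d" by simp
  have k_div: "k div d < dim_vec u * m"
    using k by (intro less_mult_imp_div_less) (simp add: mult.assoc)
  have "(u \<otimes>\<^sub>v v \<otimes>\<^sub>v w) $ k = u $ (k div d div m) * v $ (k div d mod m) * w $ (k mod d)"
    using k k_div by (simp add: m_def d_def mult.assoc)
  moreover have "k div d div m = k div (m * d)"
    by (simp only: div_mult2_eq mult.commute[of m d])
  moreover have "k div d mod m = k mod (m * d) div d"
    using \<open>m * d > 0\<close> mod_mult2_eq[of k d m] by (simp add: mult.commute[of m d])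
  moreover have "k mod d = k mod (m * d) mod d"
    by (simp only: mod_mod_cancel[OF dvd_triv_right])
  moreover have "(u \<otimes>\<^sub>v (v \<otimes>\<^sub>v w)) $ k =
      u $ (k div (m * d)) * (v $ (k mod (m * d) div d) * w $ (k mod (m * d) mod d))"
    using k k_mod by (simp add: m_def d_def del: mod_mod_cancel)
  ultimately show "(u \<otimes>\<^sub>v v \<otimes>\<^sub>v w) $ k = (u \<otimes>\<^sub>v (v \<otimes>\<^sub>v w)) $ k"
    by (simp only: mult.assoc)
qed simp

lemma tensor_unit_vec:
  assumes "b < m" "h < d"
  shows "unit_vec m b \<otimes>\<^sub>v unit_vec d h = (unit_vec (m * d) (b * d + h) :: 'a::semiring_1 vec)"
proof (rule eq_vecI)
  fix k assume "k < dim_vec (unit_vec (m * d) (b * d + h) :: 'a vec)"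
  then have k: "k < m * d" by simp
  then have "k div d < m" "k mod d < d" using assms by (simp_all add: less_mult_imp_div_less)
  moreover have "k = b * d + h \<longleftrightarrow> k div d = b \<and> k mod d = h"
  proof
    assume "k div d = b \<and> k mod d = h"
    then show "k = b * d + h" using div_mult_mod_eq[of k d] by metis
  qed (use assms in simp)
  ultimately show "(unit_vec m b \<otimes>\<^sub>v unit_vec d h) $ k =
    (unit_vec (m * d) (b * d + h) :: 'a vec) $ k"
    using k by (simp add: unit_vec_def)
qed simp

text \<open>The matrix of \<open>\<Sum>\<^sub>u W u \<otimes> |\<pi> u\<rangle>\<langle>u|\<close>.\<close>
definition controlled :: "nat \<Rightarrow> nat \<Rightarrow> (nat \<Rightarrow> 'a::zero mat) \<Rightarrow> (nat \<Rightarrow> nat) \<Rightarrow> 'a mat" where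
  "controlled n d W \<pi> = mat (n * d) (n * d) (\<lambda>(r, c).
     if r mod d = \<pi> (c mod d) then W (c mod d) $$ (r div d, c div d) else 0)"

abbreviation ampliation :: "nat \<Rightarrow> nat \<Rightarrow> 'a::zero mat \<Rightarrow> 'a mat" where
  "ampliation n d A \<equiv> controlled n d (\<lambda>_. A) id"

lemma controlled_carrier [simp]: "controlled n d W \<pi> \<in> carrier_mat (n * d) (n * d)"
  by (simp add: controlled_def)

lemma dim_controlled [simp]:
  "dim_row (controlled n d W \<pi>) = n * d" "dim_col (controlled n d W \<pi>) = n * d"
  by (simp_all add: controlled_def)

lemma controlled_mult_tensor:
  fixes W :: "nat \<Rightarrow> 'a::semiring_1 mat"
  assumes W: "W u \<in> carrier_mat n n" and v: "v \<in> carrier_vec n" and u: "u < d"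
  shows "controlled n d W \<pi> *\<^sub>v (v \<otimes>\<^sub>v unit_vec d u) = (W u *\<^sub>v v) \<otimes>\<^sub>v unit_vec d (\<pi> u)"
proof (rule eq_vecI)
  fix r assume "r < dim_vec ((W u *\<^sub>v v) \<otimes>\<^sub>v unit_vec d (\<pi> u))"
  then have r: "r < n * d" using W by simp
  have "(controlled n d W \<pi> *\<^sub>v (v \<otimes>\<^sub>v unit_vec d u)) $ r =
    (\<Sum>k<n * d. controlled n d W \<pi> $$ (r, k) * (v \<otimes>\<^sub>v unit_vec d u) $ k)"
    using r v by (subst index_mult_mat_vec_sum) auto
  also have "\<dots> = (\<Sum>k<n * d. if k mod d = u then
      (if r mod d = \<pi> u then W u $$ (r div d, k div d) * v $ (k div d) else 0) else 0)"
    using r u v by (intro sum.cong) (auto simp: controlled_def)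
  also have "\<dots> = (if r mod d = \<pi> u then \<Sum>x<n. W u $$ (r div d, x) * v $ x else 0)"
    using u by (simp add: sum_if_mod_eq)
  also have "\<dots> = ((W u *\<^sub>v v) \<otimes>\<^sub>v unit_vec d (\<pi> u)) $ r"
    using r u W v
    by (auto simp: index_mult_mat_vec_sum less_mult_imp_div_less unit_vec_def
        simp del: index_mult_mat_vec)
  finally show "(controlled n d W \<pi> *\<^sub>v (v \<otimes>\<^sub>v unit_vec d u)) $ r =
    ((W u *\<^sub>v v) \<otimes>\<^sub>v unit_vec d (\<pi> u)) $ r" .
qed (use W in simp)

lemma controlled_unitary:
  assumes W: "\<And>u. u < d \<Longrightarrow> is_unitary n (W u)"
    and inj: "inj_on \<pi> {..<d}" and \<pi>: "\<And>u. u < d \<Longrightarrow> \<pi> u < d"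
  shows "is_unitary (n * d) (controlled n d W \<pi>)"
proof (rule is_unitaryI[OF controlled_carrier], rule eq_matI)
  let ?C = "controlled n d W \<pi>"
  fix r c
  assume "r < dim_row (1\<^sub>m (n * d) :: complex mat)" "c < dim_col (1\<^sub>m (n * d) :: complex mat)"
  then have rc: "r < n * d" "c < n * d" by auto
  then have d: "d > 0" by (intro Nat.gr0I) auto
  define u v x y where "u = r mod d" and "v = c mod d" and "x = r div d" and "y = c div d"
  have uv: "u < d" "v < d" and xy: "x < n" "y < n"
    using d rc by (auto simp: u_def v_def x_def y_def less_mult_imp_div_less)
  have "(mat_adjoint ?C * ?C) $$ (r, c) = (\<Sum>k<n * d. cnj (?C $$ (k, r)) * ?C $$ (k, c))"
    using rc by (subst index_mult_mat_sum) (auto simp: conjugate_complex_def)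
  also have "\<dots> = (\<Sum>k<n * d. if k mod d = \<pi> u then
      (if \<pi> u = \<pi> v then cnj (W u $$ (k div d, x)) * W v $$ (k div d, y) else 0) else 0)"
    using rc by (intro sum.cong) (auto simp: controlled_def u_def v_def x_def y_def)
  also have "\<dots> = (if \<pi> u = \<pi> v then \<Sum>z<n. cnj (W u $$ (z, x)) * W v $$ (z, y) else 0)"
    using \<pi>[OF uv(1)] d by (simp add: sum_if_mod_eq)
  also have "\<dots> = (if u = v then (mat_adjoint (W u) * W u) $$ (x, y) else 0)"
    using xy is_unitary_carrier[OF W[OF uv(1)]] inj uv
    by (auto simp: inj_on_eq_iff index_mult_mat_sum conjugate_complex_def
        simp del: index_mult_mat(1))
  also have "\<dots> = (if u = v \<and> x = y then 1 else 0)"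
    using W[OF uv(1)] xy by (auto simp: is_unitary_def simp del: index_mult_mat(1))
  also have "\<dots> = 1\<^sub>m (n * d) $$ (r, c)"
  proof -
    have "u = v \<and> x = y \<longleftrightarrow> r = c"
      unfolding u_def v_def x_def y_def by (metis mod_div_decomp)
    then show ?thesis using rc by simp
  qed
  finally show "(mat_adjoint ?C * ?C) $$ (r, c) = 1\<^sub>m (n * d) $$ (r, c)" .
qed auto

lemma ampliation_unitary: "is_unitary n A \<Longrightarrow> is_unitary (n * d) (ampliation n d A)"
  by (intro controlled_unitary) auto

subsection \<open>Evolution of density matrices\<close>

definition evolve :: "complex mat \<Rightarrow> complex mat \<Rightarrow> complex mat" where
  "evolve A X = A * X * mat_adjoint A"

lemma evolve_carrier [simp]:
  "A \<in> carrier_mat n n \<Longrightarrow> X \<in> carrier_mat n n \<Longrightarrow> evolve A X \<in> carrier_mat n n"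
  unfolding evolve_def by (intro mult_carrier_mat[of _ _ n]) auto

lemma index_evolve:
  assumes "A \<in> carrier_mat n n" "X \<in> carrier_mat n n" "r < n" "c < n"
  shows "evolve A X $$ (r, c) = (\<Sum>k<n. (\<Sum>l<n. A $$ (r, l) * X $$ (l, k)) * cnj (A $$ (c, k)))"
  unfolding evolve_def using assms
  by (subst index_mult_mat_sum)
     (auto simp: index_mult_mat_sum conjugate_complex_def simp del: index_mult_mat(1))

lemma evolve_outer:
  assumes A: "A \<in> carrier_mat n n" and v: "v \<in> carrier_vec n"
  shows "evolve A (outer v) = outer (A *\<^sub>v v)"
proof (rule eq_matI)
  fix r c assume "r < dim_row (outer (A *\<^sub>v v))" "c < dim_col (outer (A *\<^sub>v v))"
  then have rc: "r < n" "c < n" using A by (auto simp: outer_def)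
  have "evolve A (outer v) $$ (r, c) =
    (\<Sum>k<n. (\<Sum>l<n. A $$ (r, l) * (v $ l * cnj (v $ k))) * cnj (A $$ (c, k)))"
    using A v rc by (simp add: index_evolve[of _ n] outer_def)
  also have "\<dots> = (\<Sum>l<n. A $$ (r, l) * v $ l) * cnj (\<Sum>k<n. A $$ (c, k) * v $ k)"
    by (simp add: sum_distrib_left sum_distrib_right mult_ac)
  also have "\<dots> = outer (A *\<^sub>v v) $$ (r, c)"
    using A v rc by (simp add: outer_def index_mult_mat_vec_sum del: index_mult_mat_vec)
  finally show "evolve A (outer v) $$ (r, c) = outer (A *\<^sub>v v) $$ (r, c)" .
qed (use A v in \<open>auto simp: outer_def evolve_def\<close>)

lemma evolve_linear:
  assumes "A \<in> carrier_mat n n" "X \<in> carrier_mat n n" "Y \<in> carrier_mat n n"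
  shows "evolve A (a \<cdot>\<^sub>m X + b \<cdot>\<^sub>m Y) = a \<cdot>\<^sub>m evolve A X + b \<cdot>\<^sub>m evolve A Y"
  unfolding evolve_def mult_mat_linear[OF assms] using assms
  by (subst add_mult_distrib_mat[OF _ _ mat_adjoint_carrier[OF assms(1)]])
     (auto simp: mult_smult_assoc_mat[OF _ mat_adjoint_carrier[OF assms(1)]])

lemma index_evolve_ampliation:
  assumes A: "A \<in> carrier_mat n n" and X: "X \<in> carrier_mat (n * d) (n * d)"
    and rc: "r < n * d" "c < n * d"
  shows "evolve (ampliation n d A) X $$ (r, c) =
    evolve A (mat n n (\<lambda>(x, y). X $$ (x * d + r mod d, y * d + c mod d))) $$ (r div d, c div d)"
proof -
  have d: "d > 0" using rc by (intro Nat.gr0I) auto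
  have row: "(\<Sum>l<n * d. ampliation n d A $$ (q, l) * g l) =
    (\<Sum>x<n. A $$ (q div d, x) * g (x * d + q mod d))" if "q < n * d" for q and g :: "nat \<Rightarrow> complex"
  proof -
    have "(\<Sum>l<n * d. ampliation n d A $$ (q, l) * g l) =
      (\<Sum>l<n * d. if l mod d = q mod d then A $$ (q div d, l div d) * g l else 0)"
      using that by (intro sum.cong) (auto simp: controlled_def)
    then show ?thesis using d by (simp add: sum_if_mod_eq)
  qed
  have "evolve (ampliation n d A) X $$ (r, c) = (\<Sum>k<n * d.
      (\<Sum>x<n. A $$ (r div d, x) * X $$ (x * d + r mod d, k)) * cnj (ampliation n d A $$ (c, k)))"
    using X rc by (subst index_evolve[of _ "n * d"]) (auto simp: row)
  also have "\<dots> = cnj (\<Sum>k<n * d. ampliation n d A $$ (c, k) *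
      cnj (\<Sum>x<n. A $$ (r div d, x) * X $$ (x * d + r mod d, k)))"
    by (simp add: mult.commute)
  also have "\<dots> = (\<Sum>y<n. (\<Sum>x<n. A $$ (r div d, x) * X $$ (x * d + r mod d, y * d + c mod d)) *
      cnj (A $$ (c div d, y)))"
    by (subst row[OF rc(2)]) (simp add: mult.commute)
  also have "\<dots> = evolve A (mat n n (\<lambda>(x, y). X $$ (x * d + r mod d, y * d + c mod d)))
      $$ (r div d, c div d)"
    using A rc by (subst index_evolve[of _ n]) (auto simp: less_mult_imp_div_less)
  finally show ?thesis .
qed

lemma tensor_id_carrier: "tensor_id n d \<Phi> X \<in> carrier_mat (n * d) (n * d)"
  by (simp add: tensor_id_def)

lemma tensor_id_oracle_channel:
  assumes A: "A \<in> carrier_mat n n" and X: "X \<in> carrier_mat (n * d) (n * d)"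
  shows "tensor_id n d (oracle_channel p A) X =
    of_real p \<cdot>\<^sub>m evolve (ampliation n d A) X + of_real (1 - p) \<cdot>\<^sub>m X"
proof (rule eq_matI)
  fix r c
  assume "r < dim_row (of_real p \<cdot>\<^sub>m evolve (ampliation n d A) X + of_real (1 - p) \<cdot>\<^sub>m X)"
    and "c < dim_col (of_real p \<cdot>\<^sub>m evolve (ampliation n d A) X + of_real (1 - p) \<cdot>\<^sub>m X)"
  then have rc: "r < n * d" "c < n * d" using X by auto
  define Y where "Y = mat n n (\<lambda>(x, y). X $$ (x * d + r mod d, y * d + c mod d))"
  have Y: "Y \<in> carrier_mat n n" by (simp add: Y_def)
  have rc': "r div d < n" "c div d < n" using rc by (auto simp: less_mult_imp_div_less)
  have "tensor_id n d (oracle_channel p A) X $$ (r, c) =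
    of_real p * evolve A Y $$ (r div d, c div d) + of_real (1 - p) * Y $$ (r div d, c div d)"
    using rc rc' evolve_carrier[OF A Y] Y
    by (simp add: tensor_id_def oracle_channel_def flip: Y_def evolve_def)
  also have "Y $$ (r div d, c div d) = X $$ (r, c)"
    using rc' by (simp add: Y_def)
  also have "evolve A Y $$ (r div d, c div d) = evolve (ampliation n d A) X $$ (r, c)"
    using index_evolve_ampliation[OF A X rc] by (simp add: Y_def)
  finally show "tensor_id n d (oracle_channel p A) X $$ (r, c) =
    (of_real p \<cdot>\<^sub>m evolve (ampliation n d A) X + of_real (1 - p) \<cdot>\<^sub>m X) $$ (r, c)"
    using rc X by (simp add: evolve_def)
qed (use X in \<open>auto simp: tensor_id_def\<close>)

lemma tensor_id_oracle_channel_linear: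
  assumes A: "A \<in> carrier_mat n n"
    and X: "X \<in> carrier_mat (n * d) (n * d)" and Y: "Y \<in> carrier_mat (n * d) (n * d)"
  shows "tensor_id n d (oracle_channel p A) (a \<cdot>\<^sub>m X + b \<cdot>\<^sub>m Y) =
    a \<cdot>\<^sub>m tensor_id n d (oracle_channel p A) X + b \<cdot>\<^sub>m tensor_id n d (oracle_channel p A) Y"
proof -
  note B = controlled_carrier[of n d "\<lambda>_. A" id]
  show ?thesis
    using X Y evolve_carrier[OF B X] evolve_carrier[OF B Y]
    by (intro eq_matI)
       (simp_all add: tensor_id_oracle_channel[OF A] evolve_linear[OF B] algebra_simps)
qed

subsection \<open>Measurements in the computational basis\<close>

lemma is_psd_mat_diag:
  assumes "\<And>r. r < n \<Longrightarrow> 0 \<le> f r"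
  shows "is_psd n (mat_diag n (\<lambda>r. complex_of_real (f r)))"
  unfolding is_psd_def Let_def
proof (intro conjI ballI)
  fix v :: "complex vec" assume v: "v \<in> carrier_vec n"
  have "(mat_diag n (\<lambda>r. complex_of_real (f r)) *\<^sub>v v) $ r = of_real (f r) * v $ r" if "r < n" for r
  proof -
    have "(mat_diag n (\<lambda>r. complex_of_real (f r)) *\<^sub>v v) $ r =
      (\<Sum>c<n. if r = c then of_real (f c) * v $ c else 0)"
      using v that
      by (subst index_mult_mat_vec_sum)
         (auto simp: mat_diag_def if_distrib[of "\<lambda>z. z * _"] cong: if_cong)
    then show ?thesis using that by simp
  qed
  then have "conjugate v \<bullet> (mat_diag n (\<lambda>r. complex_of_real (f r)) *\<^sub>v v) =
    (\<Sum>r<n. cnj (v $ r) * (of_real (f r) * v $ r))"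
    using v by (auto simp: scalar_prod_def lessThan_atLeast0 mat_diag_def conjugate_complex_def
        simp del: index_mult_mat_vec intro!: sum.cong)
  also have "\<dots> = of_real (\<Sum>r<n. f r * (cmod (v $ r))\<^sup>2)"
    by (simp add: complex_norm_square mult_ac del: of_real_power)
  finally have "conjugate v \<bullet> (mat_diag n (\<lambda>r. complex_of_real (f r)) *\<^sub>v v) =
    of_real (\<Sum>r<n. f r * (cmod (v $ r))\<^sup>2)" .
  then show "Im (conjugate v \<bullet> (mat_diag n (\<lambda>r. complex_of_real (f r)) *\<^sub>v v)) = 0"
    "Re (conjugate v \<bullet> (mat_diag n (\<lambda>r. complex_of_real (f r)) *\<^sub>v v)) \<ge> 0"
    using assms by (auto intro!: sum_nonneg)
qed simp

definition first_proj :: "nat \<Rightarrow> nat \<Rightarrow> nat \<Rightarrow> complex mat" where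
  "first_proj n d i = mat_diag (n * d) (\<lambda>r. of_bool (r div d = i))"

lemma first_proj_carrier: "first_proj n d i \<in> carrier_mat (n * d) (n * d)"
  by (simp add: first_proj_def)

lemma first_proj_povm: "is_povm (n * d) n (first_proj n d)"
proof -
  have "is_psd (n * d) (first_proj n d j)" for j
    using is_psd_mat_diag[of "n * d" "\<lambda>r. of_bool (r div d = j)"]
    by (simp add: first_proj_def of_bool_def if_distrib cong: if_cong)
  moreover have "(\<Sum>j<n. first_proj n d j $$ (r, c)) = 1\<^sub>m (n * d) $$ (r, c)"
    if "r < n * d" "c < n * d" for r c
    using that by (auto simp: first_proj_def mat_diag_def less_mult_imp_div_less of_bool_def)
  ultimately show ?thesis by (simp add: is_povm_def)
qed

lemma mtrace_linear:
  assumes "A \<in> carrier_mat n n" "X \<in> carrier_mat n n" "Y \<in> carrier_mat n n"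
  shows "mtrace (A * (a \<cdot>\<^sub>m X + b \<cdot>\<^sub>m Y)) = a * mtrace (A * X) + b * mtrace (A * Y)"
  unfolding mult_mat_linear[OF assms] using assms
  by (simp add: mtrace_def sum.distrib sum_distrib_left del: index_mult_mat(1))

lemma mtrace_first_proj_outer:
  assumes v: "v \<in> carrier_vec n" and iu: "i < n" "u < d"
  shows "mtrace (first_proj n d i * outer (v \<otimes>\<^sub>v unit_vec d u)) = of_real ((cmod (v $ i))\<^sup>2)"
proof -
  have X: "outer (v \<otimes>\<^sub>v unit_vec d u) \<in> carrier_mat (n * d) (n * d)" using v by simp
  have "mtrace (first_proj n d i * outer (v \<otimes>\<^sub>v unit_vec d u)) =
    (\<Sum>r<n * d. of_bool (r div d = i) * outer (v \<otimes>\<^sub>v unit_vec d u) $$ (r, r))"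
    by (simp add: first_proj_def mat_diag_mult_left[OF X] mtrace_def)
  also have "\<dots> =
    (\<Sum>r<n * d. if r mod d = u then (if r div d = i then v $ i * cnj (v $ i) else 0) else 0)"
    using v iu by (intro sum.cong) (auto simp: outer_def)
  also have "\<dots> = (\<Sum>x<n. if x = i then v $ i * cnj (v $ i) else 0)"
    using iu by (simp add: sum_if_mod_eq)
  also have "\<dots> = of_real ((cmod (v $ i))\<^sup>2)"
    using iu by (simp add: complex_norm_square del: of_real_power)
  finally show ?thesis .
qed

subsection \<open>Feedback on heralded queries\<close>

definition phase_flip :: "nat \<Rightarrow> complex vec \<Rightarrow> complex vec" where
  "phase_flip i v = vec (dim_vec v) (\<lambda>j. if j = i then - v $ j else v $ j)"

lemma phase_flip_carrier [simp]: "v \<in> carrier_vec n \<Longrightarrow> phase_flip i v \<in> carrier_vec n"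
  by (simp add: phase_flip_def)

lemma dim_phase_flip [simp]: "dim_vec (phase_flip i v) = dim_vec v"
  by (simp add: phase_flip_def)

lemma cmod_index_phase_flip: "i < dim_vec v \<Longrightarrow> cmod (phase_flip i v $ i) = cmod (v $ i)"
  by (simp add: phase_flip_def)

definition phase_oracle :: "nat \<Rightarrow> nat \<Rightarrow> complex mat \<Rightarrow> bool" where
  "phase_oracle N i A \<longleftrightarrow> A \<in> carrier_mat (2*N) (2*N) \<and>
     (\<forall>j<N. A *\<^sub>v unit_vec (2*N) (2*j) = (if j = i then -1 else 1) \<cdot>\<^sub>v unit_vec (2*N) (2*j+1))"

lemma phase_oracle_carrier: "phase_oracle N i A \<Longrightarrow> A \<in> carrier_mat (2*N) (2*N)"
  by (simp add: phase_oracle_def)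

lemma phase_oracle_index:
  assumes A: "phase_oracle N i A" and r: "r < 2*N" and j: "j < N"
  shows "A $$ (r, 2*j) = (if r = 2*j+1 then if j = i then -1 else 1 else 0)"
proof -
  have "A $$ (r, 2*j) = (A *\<^sub>v unit_vec (2*N) (2*j)) $ r"
    using mult_mat_unit_vec[of "2*j" A] phase_oracle_carrier[OF A] r j by simp
  also have "\<dots> = ((if j = i then -1 else 1) \<cdot>\<^sub>v unit_vec (2*N) (2*j+1)) $ r"
    using A j by (simp add: phase_oracle_def)
  finally show ?thesis using r j by simp
qed

lemma phase_oracle_mult_vec:
  assumes A: "phase_oracle N i A" and v: "v \<in> carrier_vec N"
  shows "A *\<^sub>v (v \<otimes>\<^sub>v unit_vec 2 0) = phase_flip i v \<otimes>\<^sub>v unit_vec 2 1"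
proof (rule eq_vecI)
  fix r assume "r < dim_vec (phase_flip i v \<otimes>\<^sub>v unit_vec 2 1)"
  then have r: "r < 2*N" using v by simp
  have "(A *\<^sub>v (v \<otimes>\<^sub>v unit_vec 2 0)) $ r = (\<Sum>k<N * 2. A $$ (r, k) * (v \<otimes>\<^sub>v unit_vec 2 0) $ k)"
    using phase_oracle_carrier[OF A] r v by (subst index_mult_mat_vec_sum) auto
  also have "\<dots> = (\<Sum>k<N * 2. if k mod 2 = 0 then A $$ (r, k) * v $ (k div 2) else 0)"
    using v by (intro sum.cong) auto
  also have "\<dots> = (\<Sum>j<N. A $$ (r, 2*j) * v $ j)"
    by (subst sum_if_mod_eq) (simp_all add: mult.commute)
  also have "\<dots> = (\<Sum>j<N. if j = r div 2 then if r mod 2 = 1 then phase_flip i v $ j else 0 else 0)"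
  proof (rule sum.cong)
    fix j assume j: "j \<in> {..<N}"
    have "r = 2*j+1 \<longleftrightarrow> j = r div 2 \<and> r mod 2 = 1" by presburger
    then show "A $$ (r, 2*j) * v $ j =
      (if j = r div 2 then if r mod 2 = 1 then phase_flip i v $ j else 0 else 0)"
      using v j by (auto simp: phase_oracle_index[OF A r] phase_flip_def)
  qed simp
  also have "\<dots> = (phase_flip i v \<otimes>\<^sub>v unit_vec 2 1) $ r"
    using r v by (auto simp: unit_vec_def)
  finally show "(A *\<^sub>v (v \<otimes>\<^sub>v unit_vec 2 0)) $ r = (phase_flip i v \<otimes>\<^sub>v unit_vec 2 1) $ r" .
qed (use v phase_oracle_carrier[OF A] in simp)

lemma phase_oracle_ampliation:
  assumes A: "phase_oracle N i A" and v: "v \<in> carrier_vec N" and h: "h < d"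
  shows "ampliation (2*N) d A *\<^sub>v (v \<otimes>\<^sub>v unit_vec (2*d) h) =
    phase_flip i v \<otimes>\<^sub>v unit_vec (2*d) (d + h)"
proof -
  have split: "w \<otimes>\<^sub>v unit_vec (2*d) (b * d + h) = w \<otimes>\<^sub>v unit_vec 2 b \<otimes>\<^sub>v unit_vec d h"
    if "b < 2" for b and w :: "complex vec"
    using that h by (simp add: tensor_vec_assoc tensor_unit_vec)
  have "v \<otimes>\<^sub>v unit_vec 2 0 \<in> carrier_vec (2*N)"
    using tensor_vec_carrier[OF v, of "unit_vec 2 0" 2] by (simp add: mult.commute)
  then have "ampliation (2*N) d A *\<^sub>v (v \<otimes>\<^sub>v unit_vec 2 0 \<otimes>\<^sub>v unit_vec d h) =
    phase_flip i v \<otimes>\<^sub>v unit_vec 2 1 \<otimes>\<^sub>v unit_vec d h"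
    using phase_oracle_carrier[OF A] h
    by (simp add: controlled_mult_tensor phase_oracle_mult_vec[OF A v])
  then show ?thesis using split[of 0 v] split[of 1 "phase_flip i v"] by simp
qed

text \<open>
  For \<open>d\<close> a power of two this is the cyclic bit rotation of \<open>u = b * d + h\<close>: it appends the
  outcome \<open>b\<close> of the last query to the history \<open>h\<close> and puts a fresh zero in its place.
\<close>
definition record_outcome :: "nat \<Rightarrow> nat \<Rightarrow> nat" where
  "record_outcome d u = (if u < d then 2 * u else 2 * (u - d) + 1)"

lemma inj_on_record_outcome: "inj_on (record_outcome d) {..<2*d}"
  by (rule inj_on_inverseI[where g = "\<lambda>v. if even v then v div 2 else v div 2 + d"])
     (auto simp: record_outcome_def)

lemma record_outcome_less: "u < 2 * d \<Longrightarrow> record_outcome d u < 2 * d"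
  by (auto simp: record_outcome_def)

definition feedback_step :: "nat \<Rightarrow> nat \<Rightarrow> (nat \<Rightarrow> complex mat) \<Rightarrow> complex mat" where
  "feedback_step N d V = controlled N (2*d) (\<lambda>u. V (record_outcome d u)) (record_outcome d)"

lemma feedback_step_carrier: "feedback_step N d V \<in> carrier_mat (2*N*d) (2*N*d)"
  using controlled_carrier[of N "2*d"] by (simp add: feedback_step_def mult_ac)

lemma feedback_step_unitary:
  assumes "\<And>h. is_unitary N (V h)"
  shows "is_unitary (2*N*d) (feedback_step N d V)"
proof -
  have "is_unitary (N * (2*d)) (feedback_step N d V)"
    unfolding feedback_step_def
    by (intro controlled_unitary assms inj_on_record_outcome record_outcome_less)
  then show ?thesis by (simp add: mult_ac)
qed

definition history_state :: "nat \<Rightarrow> complex vec \<Rightarrow> nat \<Rightarrow> complex mat" where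
  "history_state d v u = outer (v \<otimes>\<^sub>v unit_vec (2*d) u)"

lemma tensor_history_carrier:
  fixes v :: "complex vec"
  assumes "v \<in> carrier_vec N"
  shows "v \<otimes>\<^sub>v unit_vec (2*d) u \<in> carrier_vec (2*N*d)"
  using tensor_vec_carrier[OF assms, of "unit_vec (2*d) u" "2*d"] by (simp add: mult_ac)

lemma history_state_carrier:
  "v \<in> carrier_vec N \<Longrightarrow> history_state d v u \<in> carrier_mat (2*N*d) (2*N*d)"
  by (simp add: history_state_def tensor_history_carrier)

lemma evolve_feedback_step_history_state:
  assumes "\<And>h. V h \<in> carrier_mat N N" "v \<in> carrier_vec N" "u < 2*d"
  shows "evolve (feedback_step N d V) (history_state d v u) =
    history_state d (V (record_outcome d u) *\<^sub>v v) (record_outcome d u)"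
proof -
  have "feedback_step N d V *\<^sub>v (v \<otimes>\<^sub>v unit_vec (2*d) u) =
    (V (record_outcome d u) *\<^sub>v v) \<otimes>\<^sub>v unit_vec (2*d) (record_outcome d u)"
    using assms by (simp add: feedback_step_def controlled_mult_tensor)
  then show ?thesis
    using assms(2)
    by (simp add: history_state_def evolve_outer[OF feedback_step_carrier] tensor_history_carrier)
qed

lemma tensor_id_phase_oracle_history_state:
  assumes A: "phase_oracle N i A" and v: "v \<in> carrier_vec N" and h: "h < d"
  shows "tensor_id (2*N) d (oracle_channel p A) (history_state d v h) =
    of_real p \<cdot>\<^sub>m history_state d (phase_flip i v) (d + h) +
    of_real (1 - p) \<cdot>\<^sub>m history_state d v h"
  unfolding tensor_id_oracle_channel[OF phase_oracle_carrier[OF A] history_state_carrier[OF v]]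
  unfolding history_state_def
  using v by (simp add: evolve_outer[OF controlled_carrier] tensor_history_carrier
      phase_oracle_ampliation[OF A v h])

definition feedback_round ::
    "nat \<Rightarrow> nat \<Rightarrow> real \<Rightarrow> complex mat \<Rightarrow> (nat \<Rightarrow> complex mat) \<Rightarrow> complex mat \<Rightarrow> complex mat" where
  "feedback_round N d p A V X =
     evolve (feedback_step N d V) (tensor_id (2*N) d (oracle_channel p A) X)"

lemma feedback_round_carrier: "feedback_round N d p A V X \<in> carrier_mat (2*N*d) (2*N*d)"
  unfolding feedback_round_def
  by (intro evolve_carrier feedback_step_carrier tensor_id_carrier)

lemma funpow_feedback_round_carrier:
  assumes "X \<in> carrier_mat (2*N*d) (2*N*d)"
  shows "(feedback_round N d p A V ^^ n) X \<in> carrier_mat (2*N*d) (2*N*d)"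
  using assms by (cases n) (simp_all add: feedback_round_carrier)

lemma feedback_round_linear:
  assumes "A \<in> carrier_mat (2*N) (2*N)"
    and "X \<in> carrier_mat (2*N*d) (2*N*d)" "Y \<in> carrier_mat (2*N*d) (2*N*d)"
  shows "feedback_round N d p A V (a \<cdot>\<^sub>m X + b \<cdot>\<^sub>m Y) =
    a \<cdot>\<^sub>m feedback_round N d p A V X + b \<cdot>\<^sub>m feedback_round N d p A V Y"
  unfolding feedback_round_def tensor_id_oracle_channel_linear[OF assms]
  by (intro evolve_linear[OF feedback_step_carrier] tensor_id_carrier)

lemma funpow_feedback_round_linear:
  assumes "A \<in> carrier_mat (2*N) (2*N)"
    and "X \<in> carrier_mat (2*N*d) (2*N*d)" "Y \<in> carrier_mat (2*N*d) (2*N*d)"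
  shows "(feedback_round N d p A V ^^ n) (a \<cdot>\<^sub>m X + b \<cdot>\<^sub>m Y) =
    a \<cdot>\<^sub>m (feedback_round N d p A V ^^ n) X + b \<cdot>\<^sub>m (feedback_round N d p A V ^^ n) Y"
  using assms
  by (induction n) (simp_all add: feedback_round_linear funpow_feedback_round_carrier)

lemma feedback_round_history_state:
  assumes A: "phase_oracle N i A" and V: "\<And>h. V h \<in> carrier_mat N N"
    and v: "v \<in> carrier_vec N" and h: "h < d"
  shows "feedback_round N d p A V (history_state d v h) =
    of_real p \<cdot>\<^sub>m history_state d (V (2*h+1) *\<^sub>v phase_flip i v) (2*h+1) +
    of_real (1 - p) \<cdot>\<^sub>m history_state d (V (2*h) *\<^sub>v v) (2*h)"
proof -
  have "evolve (feedback_step N d V) (history_state d (phase_flip i v) (d + h)) =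
      history_state d (V (2*h+1) *\<^sub>v phase_flip i v) (2*h+1)"
    and "evolve (feedback_step N d V) (history_state d v h) =
      history_state d (V (2*h) *\<^sub>v v) (2*h)"
    using V v h by (simp_all add: evolve_feedback_step_history_state record_outcome_def)
  then show ?thesis
    using v by (simp add: feedback_round_def tensor_id_phase_oracle_history_state[OF A v h]
        evolve_linear[OF feedback_step_carrier] history_state_carrier)
qed

text \<open>
  The probability that after \<open>n\<close> further queries the measurement yields \<open>i\<close>. The binary digits of
  the history \<open>h\<close> record which of the earlier queries succeeded; \<open>V h\<close> is applied on reaching \<open>h\<close>.
  Thus \<open>h\<close> is odd when the last query succeeded, and \<open>1\<close> when that was the first success.
\<close>
fun search_prob :: "real \<Rightarrow> (nat \<Rightarrow> complex mat) \<Rightarrow> nat \<Rightarrow> nat \<Rightarrow> complex vec \<Rightarrow> nat \<Rightarrow> real" where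
  "search_prob p V i 0 v h = (cmod (v $ i))\<^sup>2"
| "search_prob p V i (Suc n) v h =
     p * search_prob p V i n (V (2*h+1) *\<^sub>v phase_flip i v) (2*h+1)
     + (1 - p) * search_prob p V i n (V (2*h) *\<^sub>v v) (2*h)"

lemma funpow_feedback_round_outcome:
  assumes A: "phase_oracle N i A" and V: "\<And>h. V h \<in> carrier_mat N N" and i: "i < N"
    and "v \<in> carrier_vec N" and "(h + 1) * 2 ^ n \<le> 2*d"
  shows "mtrace (first_proj N (2*d) i * (feedback_round N d p A V ^^ n) (history_state d v h)) =
    of_real (search_prob p V i n v h)"
  using assms(4,5)
proof (induction n arbitrary: v h)
  case 0
  then show ?case using i by (simp add: history_state_def mtrace_first_proj_outer)
next
  case (Suc n)
  let ?R = "feedback_round N d p A V" and ?M = "first_proj N (2*d) i"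
  let ?v\<^sub>1 = "V (2*h+1) *\<^sub>v phase_flip i v" and ?v\<^sub>0 = "V (2*h) *\<^sub>v v"
  let ?X\<^sub>1 = "history_state d ?v\<^sub>1 (2*h+1)" and ?X\<^sub>0 = "history_state d ?v\<^sub>0 (2*h)"
  have v: "?v\<^sub>1 \<in> carrier_vec N" "?v\<^sub>0 \<in> carrier_vec N"
    using Suc.prems V by (auto intro!: mult_mat_vec_carrier[of _ N N])
  note X = v[THEN history_state_carrier]
  have M: "?M \<in> carrier_mat (2*N*d) (2*N*d)"
    using first_proj_carrier[of N "2*d" i] by (simp add: mult_ac)
  have h: "(2*h+1+1) * 2 ^ n \<le> 2*d" "(2*h+1) * 2 ^ n \<le> 2*d"
    using Suc.prems(2) by (auto simp: algebra_simps)
  have "(h + 1) * 1 \<le> (h + 1) * 2 ^ n" by (intro mult_le_mono2) simp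
  then have "h < d" using h by (simp add: algebra_simps)
  then have "(?R ^^ Suc n) (history_state d v h) =
    (?R ^^ n) (of_real p \<cdot>\<^sub>m ?X\<^sub>1 + of_real (1 - p) \<cdot>\<^sub>m ?X\<^sub>0)"
    by (simp add: feedback_round_history_state[OF A V Suc.prems(1)] funpow_Suc_right
        del: funpow.simps(2))
  also have "\<dots> = of_real p \<cdot>\<^sub>m (?R ^^ n) ?X\<^sub>1 + of_real (1 - p) \<cdot>\<^sub>m (?R ^^ n) ?X\<^sub>0"
    by (intro funpow_feedback_round_linear phase_oracle_carrier[OF A] X)
  finally have "mtrace (?M * (?R ^^ Suc n) (history_state d v h)) =
    of_real p * mtrace (?M * (?R ^^ n) ?X\<^sub>1) + of_real (1 - p) * mtrace (?M * (?R ^^ n) ?X\<^sub>0)"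
    by (simp only: mtrace_linear[OF M] funpow_feedback_round_carrier X)
  then show ?case
    using Suc.IH[OF v(1) h(1)] Suc.IH[OF v(2) h(2)] by simp
qed

lemma alg_final_state_rounds:
  assumes "D > 0"
  shows "alg_final_state D \<Phi> (P # replicate n W) W =
    ((\<lambda>X. evolve W (\<Phi> X)) ^^ Suc n) (evolve P (outer (unit_vec D 0)))"
proof -
  have shift: "evolve W (((\<lambda>X. \<Phi> (evolve W X)) ^^ n) (\<Phi> X)) =
    ((\<lambda>X. evolve W (\<Phi> X)) ^^ Suc n) X" for X
    by (induction n) simp_all
  have "mat D D (\<lambda>(r, c). if r = 0 \<and> c = 0 then 1 else 0) = outer (unit_vec D 0)"
    using assms by (intro eq_matI) (auto simp: outer_def)
  then show ?thesis
    by (simp add: alg_final_state_def shift flip: evolve_def)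
qed

lemma feedback_search_outcome:
  assumes A: "phase_oracle N i A" and P: "P \<in> carrier_mat N N"
    and V: "\<And>h. V h \<in> carrier_mat N N" and i: "i < N" and d: "2 ^ n \<le> d"
  shows "Re (mtrace (first_proj N (2*d) i *
      alg_final_state (2*N*d) (tensor_id (2*N) d (oracle_channel p A))
        (ampliation N (2*d) P # replicate n (feedback_step N d V)) (feedback_step N d V))) =
    search_prob p V i (Suc n) (P *\<^sub>v unit_vec N 0) 0"
proof -
  have "d > 0" using d by (intro Nat.gr0I) auto
  then have pos: "2*N*d > 0" using i by simp
  have dims: "N * (2*d) = 2*N*d" by simp
  have "unit_vec (2*N*d) 0 = (unit_vec N 0 :: complex vec) \<otimes>\<^sub>v unit_vec (2*d) 0"
    using i \<open>d > 0\<close> by (simp add: tensor_unit_vec dims)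
  then have "evolve (ampliation N (2*d) P) (outer (unit_vec (2*N*d) 0)) =
    history_state d (P *\<^sub>v unit_vec N 0) 0"
    using P \<open>d > 0\<close>
    by (simp add: history_state_def evolve_outer[OF controlled_carrier] controlled_mult_tensor)
  then show ?thesis
    using funpow_feedback_round_outcome[OF A V i, of "P *\<^sub>v unit_vec N 0" 0 "Suc n" d p] P d
    unfolding alg_final_state_rounds[OF pos] feedback_round_def[abs_def] by simp
qed

subsection \<open>Grover iteration\<close>

definition grover_angle :: "nat \<Rightarrow> real" where
  "grover_angle N = arcsin (1 / sqrt (real N))"

lemma sin_grover_angle: "N > 0 \<Longrightarrow> sin (grover_angle N) = 1 / sqrt N"
  unfolding grover_angle_def by (intro sin_arcsin) (auto intro: order_trans[of _ 0])

lemma cos_grover_angle: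
  assumes "N > 0"
  shows "cos (grover_angle N) = sqrt (real N - 1) / sqrt N"
proof -
  have "cos (grover_angle N) = sqrt (1 - (1 / sqrt N)\<^sup>2)"
    unfolding grover_angle_def using assms
    by (intro cos_arcsin) (auto intro: order_trans[of _ 0])
  then show ?thesis
    using assms by (simp add: power_divide real_sqrt_divide[symmetric] field_simps)
qed

lemma grover_angle_pos: "N > 0 \<Longrightarrow> grover_angle N > 0"
  unfolding grover_angle_def using arcsin_less_arcsin[of 0 "1 / sqrt N"] by simp

lemma grover_angle_le:
  assumes "N > 0" "1 / sqrt N \<le> sin x" "0 \<le> x" "x \<le> pi / 2"
  shows "grover_angle N \<le> x"
proof -
  have "grover_angle N \<le> arcsin (sin x)"
    unfolding grover_angle_def using assms
    by (intro arcsin_le_arcsin) (auto intro: order_trans[of _ 0])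
  then show ?thesis using assms by (simp add: arcsin_sin)
qed

lemma grover_angle_le_pi_quarter:
  assumes "N \<ge> 2"
  shows "grover_angle N \<le> pi / 4"
proof (rule grover_angle_le)
  have "1 / sqrt N \<le> 1 / sqrt 2" using assms by (intro divide_left_mono) auto
  also have "1 / sqrt 2 = sin (pi / 4)" by (simp add: sin_45 field_simps)
  finally show "1 / sqrt N \<le> sin (pi / 4)" .
qed (use assms in auto)

definition uniform_state :: "nat \<Rightarrow> complex vec" where
  "uniform_state N = vec N (\<lambda>_. of_real (1 / sqrt N))"

definition diffusion :: "nat \<Rightarrow> complex mat" where
  "diffusion N = reflection (vec N (\<lambda>_. 1))"

lemma diffusion_unitary: "is_unitary N (diffusion N)"
  unfolding diffusion_def by (intro reflection_unitary) simp

lemma diffusion_mult_vec: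
  assumes "v \<in> carrier_vec N"
  shows "diffusion N *\<^sub>v v = vec N (\<lambda>j. 2 / of_nat N * (\<Sum>k<N. v $ k) - v $ j)"
proof -
  have "v \<bullet>c vec N (\<lambda>_. 1) = (\<Sum>k<N. v $ k)" if "v \<in> carrier_vec N" for v :: "complex vec"
    using that by (simp add: scalar_prod_def lessThan_atLeast0)
  then show ?thesis
    unfolding diffusion_def using assms
    by (intro eq_vecI) (auto simp: reflection_mult_vec[of _ N])
qed

definition grover_init :: "nat \<Rightarrow> complex mat" where
  "grover_init N = reflection (unit_vec N 0 + uniform_state N)"

lemma grover_init_unitary: "is_unitary N (grover_init N)"
  unfolding grover_init_def by (intro reflection_unitary) (simp add: uniform_state_def)

lemma grover_init_mult_unit_vec:
  assumes "N > 0"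
  shows "grover_init N *\<^sub>v unit_vec N 0 = uniform_state N"
  unfolding grover_init_def
proof (rule reflection_bisector_mult_vec)
  let ?e = "unit_vec N 0 :: complex vec" and ?s = "uniform_state N"
  show carrier: "?e \<in> carrier_vec N" "?s \<in> carrier_vec N" by (simp_all add: uniform_state_def)
  have conj: "conjugate ?s = ?s" "conjugate ?e = ?e"
    by (intro eq_vecI; simp add: uniform_state_def unit_vec_def conjugate_complex_def)+
  have "?s \<bullet> ?s = of_nat N * (of_real (1 / sqrt N) * of_real (1 / sqrt N))"
    by (simp add: uniform_state_def scalar_prod_def)
  also have "\<dots> = 1" using assms by (simp flip: of_real_mult)
  finally show "?s \<bullet>c ?s = ?e \<bullet>c ?e" using assms by (simp add: conj)
  have prod: "?e \<bullet> ?s = of_real (1 / sqrt N)" "?s \<bullet> ?e = of_real (1 / sqrt N)"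
    using assms carrier by (simp_all add: uniform_state_def)
  then show "?s \<bullet>c ?e = ?e \<bullet>c ?s" by (simp add: conj)
  have "?e \<bullet>c ?e + ?e \<bullet>c ?s = of_real (1 + 1 / sqrt N)" using assms prod by (simp add: conj)
  moreover have "1 + 1 / sqrt N > 0" by (intro add_pos_nonneg) auto
  ultimately show "?e \<bullet>c ?e + ?e \<bullet>c ?s \<noteq> 0" by (simp only: of_real_eq_0_iff)
qed

definition grover_state :: "nat \<Rightarrow> nat \<Rightarrow> real \<Rightarrow> complex vec" where
  "grover_state N i x = vec N (\<lambda>j. of_real (if j = i then sin x else cos x / sqrt (real N - 1)))"

lemma grover_state_carrier [simp]: "grover_state N i x \<in> carrier_vec N"
  by (simp add: grover_state_def)

lemma cmod_grover_state: "i < N \<Longrightarrow> (cmod (grover_state N i x $ i))\<^sup>2 = (sin x)\<^sup>2"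
  by (simp add: grover_state_def)

lemma uniform_state_eq_grover_state:
  "N \<ge> 2 \<Longrightarrow> uniform_state N = grover_state N i (grover_angle N)"
  by (auto simp: uniform_state_def grover_state_def sin_grover_angle cos_grover_angle)

lemma sum_phase_flip_grover_state:
  assumes "i < N"
  shows "(\<Sum>k<N. phase_flip i (grover_state N i x) $ k) =
    of_real (sqrt (real N - 1) * cos x - sin x)"
proof -
  have "(\<Sum>k<N. phase_flip i (grover_state N i x) $ k) =
    - of_real (sin x) + (\<Sum>k\<in>{..<N} - {i}. of_real (cos x / sqrt (real N - 1)))"
    using assms by (simp add: sum.remove[of _ i] phase_flip_def grover_state_def)
  also have "\<dots> = of_real ((real N - 1) / sqrt (real N - 1) * cos x - sin x)"
    using assms by (simp add: of_nat_diff)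
  also have "(real N - 1) / sqrt (real N - 1) = sqrt (real N - 1)"
    using assms by (intro real_div_sqrt) auto
  finally show ?thesis .
qed

lemma diffusion_phase_flip_grover_state:
  assumes N: "N \<ge> 2" and i: "i < N"
  shows "diffusion N *\<^sub>v phase_flip i (grover_state N i x) =
    grover_state N i (x + 2 * grover_angle N)"
proof -
  define r \<theta> where "r = sqrt (real N - 1)" and "\<theta> = 2 * grover_angle N"
  have r: "r > 0" "r * r = real N - 1" using N by (auto simp: r_def)
  have sin: "sin \<theta> = 2 * r / N"
    using N by (simp add: sin_double sin_grover_angle cos_grover_angle r_def \<theta>_def)
  have cos: "cos \<theta> = 1 - 2 / N"
    using N by (simp add: cos_double_sin sin_grover_angle power_divide \<theta>_def)
  have marked: "2 / N * (r * cos x - sin x) + sin x = sin (x + \<theta>)"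
    using N by (simp add: sin_add sin cos field_simps)
  have unmarked: "2 / N * (r * cos x - sin x) - cos x / r = cos (x + \<theta>) / r"
  proof -
    have "(2 / N * (r * cos x - sin x) - cos x / r) * r =
      2 / N * ((r * r) * cos x - r * sin x) - cos x"
      using r(1) by (simp add: algebra_simps)
    also have "\<dots> = cos (x + \<theta>)"
      unfolding r(2) using N by (simp add: cos_add sin cos field_simps)
    finally show ?thesis using r(1) by (simp add: eq_divide_eq)
  qed
  have "diffusion N *\<^sub>v phase_flip i (grover_state N i x) = vec N (\<lambda>j.
      of_real (2 / N * (r * cos x - sin x)) - phase_flip i (grover_state N i x) $ j)"
    by (simp add: diffusion_mult_vec sum_phase_flip_grover_state[OF i] r_def)
  also have "\<dots> = vec N (\<lambda>j. of_real (if j = i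
      then 2 / N * (r * cos x - sin x) + sin x else 2 / N * (r * cos x - sin x) - cos x / r))"
    by (intro eq_vecI) (auto simp: grover_state_def phase_flip_def r_def)
  also have "\<dots> = grover_state N i (x + \<theta>)"
    unfolding marked unmarked by (simp only: grover_state_def r_def)
  finally show ?thesis by (simp add: \<theta>_def)
qed

definition grover_strategy :: "nat \<Rightarrow> nat set \<Rightarrow> nat \<Rightarrow> complex mat" where
  "grover_strategy N S h = (if h \<in> S then diffusion N else 1\<^sub>m N)"

lemma grover_strategy_unitary: "is_unitary N (grover_strategy N S h)"
  by (simp add: grover_strategy_def diffusion_unitary is_unitary_one)

subsection \<open>Diffusion after the first success only\<close>

lemma search_prob_no_feedback:
  assumes "\<And>k. k > 1 \<Longrightarrow> V k = 1\<^sub>m N" and "h > 0" and "v \<in> carrier_vec N" and "i < N"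
  shows "search_prob p V i n v h = (cmod (v $ i))\<^sup>2"
  using assms(2,3)
  by (induction n arbitrary: v h) (auto simp: assms cmod_index_phase_flip algebra_simps)

lemma search_prob_first_success:
  assumes N: "N \<ge> 2" and i: "i < N"
  shows "search_prob p (grover_strategy N {1}) i n (grover_state N i x) 0 =
    (1 - (1 - p) ^ n) * (sin (x + 2 * grover_angle N))\<^sup>2 + (1 - p) ^ n * (sin x)\<^sup>2"
proof (induction n)
  case 0
  show ?case using i by (simp add: cmod_grover_state)
next
  case (Suc n)
  let ?V = "grover_strategy N {1}" and ?y = "x + 2 * grover_angle N"
  have "search_prob p ?V i n (?V 1 *\<^sub>v phase_flip i (grover_state N i x)) 1 = (sin ?y)\<^sup>2"
    using N i
    by (subst search_prob_no_feedback[of _ N])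
       (auto simp: grover_strategy_def diffusion_phase_flip_grover_state cmod_grover_state)
  moreover have "?V 0 *\<^sub>v grover_state N i x = grover_state N i x"
    by (simp add: grover_strategy_def)
  ultimately have "search_prob p ?V i (Suc n) (grover_state N i x) 0 =
    p * (sin ?y)\<^sup>2 + (1 - p) * ((1 - (1 - p) ^ n) * (sin ?y)\<^sup>2 + (1 - p) ^ n * (sin x)\<^sup>2)"
    by (simp add: Suc.IH del: One_nat_def)
  then show ?case by (simp add: algebra_simps)
qed

subsection \<open>Diffusion after every success\<close>

text \<open>
  The right-hand side is the expectation of the quadratic minorant of \<open>sin\<^sup>2\<close> when the number of
  Grover iterations is binomially distributed.
\<close>
lemma search_prob_every_success_ge:
  assumes minorant: "\<And>x. a - b * (x - t)\<^sup>2 \<le> (sin x)\<^sup>2"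
    and N: "N \<ge> 2" and i: "i < N" and p: "0 \<le> p" "p \<le> 1"
  defines "\<theta> \<equiv> 2 * grover_angle N"
  shows "a - b * ((x + \<theta> * p * n - t)\<^sup>2 + \<theta>\<^sup>2 * n * p * (1 - p)) \<le>
    search_prob p (grover_strategy N {h. odd h}) i n (grover_state N i x) h"
proof (induction n arbitrary: x h)
  case 0
  show ?case using i minorant by (simp add: cmod_grover_state)
next
  case (Suc n)
  let ?V = "grover_strategy N {h. odd h}" and ?\<sigma> = "\<theta>\<^sup>2 * n * p * (1 - p)"
  define u where "u = x + \<theta> * p * n - t"
  have "a - b * ((x + \<theta> * p * Suc n - t)\<^sup>2 + \<theta>\<^sup>2 * Suc n * p * (1 - p)) =
    p * (a - b * ((u + \<theta>)\<^sup>2 + ?\<sigma>)) + (1 - p) * (a - b * (u\<^sup>2 + ?\<sigma>))"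
    by (simp add: u_def power2_eq_square algebra_simps)
  also have "\<dots> \<le> p * search_prob p ?V i n (grover_state N i (x + \<theta>)) (2*h+1) +
    (1 - p) * search_prob p ?V i n (grover_state N i x) (2*h)"
    using p Suc.IH[of "x + \<theta>" "2*h+1"] Suc.IH[of x "2*h"]
    by (intro add_mono mult_left_mono) (simp_all add: u_def algebra_simps)
  also have "\<dots> = search_prob p ?V i (Suc n) (grover_state N i x) h"
    using diffusion_phase_flip_grover_state[OF N i] by (simp add: grover_strategy_def \<theta>_def)
  finally show ?case .
qed

lemma sin_ge_cubic:
  fixes x :: real
  assumes "0 \<le> x"
  shows "x - x ^ 3 / 6 \<le> sin x"
proof -
  have "\<bar>sin x - x\<bar> \<le> x ^ 3 / 6"
    using Maclaurin_sin_bound[of x 3] assms by (simp add: eval_nat_numeral sin_coeff_def)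
  then show ?thesis by linarith
qed

lemma pi_ge_3: "3 \<le> pi"
  using sin_x_le_x[of "pi / 6"] by (simp add: sin_30)

lemma pi_le_16_div_5: "pi \<le> 16 / 5"
proof (rule ccontr)
  assume "\<not> ?thesis"
  then have "sin (8/15) < sin (pi / 6)"
    using pi_less_4 by (intro sin_monotone_2pi) auto
  moreover have "sin (8/15 :: real) \<ge> 1/2"
    using sin_ge_cubic[of "8/15"] by (simp add: power3_eq_cube)
  ultimately show False by (simp add: sin_30)
qed

lemma sin_ge_quadratic:
  assumes "x \<le> pi / 2"
  shows "x - x\<^sup>2 / pi \<le> sin x"
proof (cases "0 \<le> x")
  case True
  have "x * pi \<le> pi / 2 * pi" using assms by (intro mult_right_mono) auto
  also have "\<dots> \<le> (16/5) / 2 * (16/5)"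
    using pi_le_16_div_5 by (intro mult_mono divide_right_mono) auto
  finally have "x * pi \<le> 6" by simp
  then have "x / 6 \<le> 1 / pi" by (simp add: field_simps)
  then have "x\<^sup>2 * (x / 6) \<le> x\<^sup>2 * (1 / pi)" by (intro mult_left_mono) auto
  moreover have "x\<^sup>2 * (x / 6) = x ^ 3 / 6" by (simp add: power2_eq_square power3_eq_cube)
  ultimately show ?thesis using sin_ge_cubic[OF True] by simp
next
  case False
  have "x - x\<^sup>2 / pi \<le> x" by simp
  also have "\<dots> \<le> sin x" using sin_x_le_x[of "- x"] False by simp
  finally show ?thesis .
qed

lemma cos_ge_quadratic: "pi / 4 - x\<^sup>2 / pi \<le> cos x"
proof -
  have "pi / 4 - y\<^sup>2 / pi \<le> cos y" if "0 \<le> y" for y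
  proof -
    have "(pi / 2 - y) - (pi / 2 - y)\<^sup>2 / pi \<le> cos y"
      using sin_ge_quadratic[of "pi / 2 - y"] that by (simp add: sin_diff)
    then show ?thesis by (simp add: power2_eq_square field_simps)
  qed
  from this[of "\<bar>x\<bar>"] show ?thesis by simp
qed

lemma sin_squared_ge_quadratic: "1/2 + pi / 8 - 2 / pi * (x - pi / 2)\<^sup>2 \<le> (sin x)\<^sup>2"
proof -
  have "(sin x)\<^sup>2 = (1 + cos (2 * (x - pi / 2))) / 2"
    by (simp add: cos_double_sin sin_diff cos_squared_eq)
  moreover have "2 / pi * (x - pi / 2)\<^sup>2 = (2 * (x - pi / 2))\<^sup>2 / pi / 2"
    by (simp only: power_mult_distrib) simp
  ultimately show ?thesis using cos_ge_quadratic[of "2 * (x - pi / 2)"] by simp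
qed

subsection \<open>Success probability within the query budget\<close>

definition grover_queries :: "nat \<Rightarrow> real \<Rightarrow> nat" where
  "grover_queries N p = nat \<lfloor>pi / (2 * (2 * grover_angle N) * p)\<rfloor>"

lemma grover_queries_bounds:
  assumes "N > 0" "0 < p"
  defines "\<theta> \<equiv> 2 * grover_angle N"
  shows "\<theta> * p * grover_queries N p \<le> pi / 2"
    and "pi / 2 < \<theta> * p * (grover_queries N p + 1)"
proof -
  define c where "c = 2 * \<theta> * p"
  have c: "c > 0" using assms grover_angle_pos by (simp add: c_def)
  have "real (grover_queries N p) \<le> pi / c" "pi / c < real (grover_queries N p) + 1"
    using c unfolding grover_queries_def c_def \<theta>_def by (simp_all add: divide_nonneg_pos; linarith)+
  then have "c * grover_queries N p \<le> pi" "pi < c * (grover_queries N p + 1)"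
    using c by (simp_all add: field_simps)
  then show "\<theta> * p * grover_queries N p \<le> pi / 2" "pi / 2 < \<theta> * p * (grover_queries N p + 1)"
    by (simp_all add: c_def mult_ac)
qed

lemma one_less_mult_Suc_grover_queries:
  assumes "N \<ge> 2" "0 < p"
  shows "1 < p * (grover_queries N p + 1)"
proof -
  define K where "K = p * (grover_queries N p + 1)"
  have "pi / 2 < 2 * grover_angle N * K"
    using grover_queries_bounds(2)[of N p] assms by (simp add: K_def mult_ac)
  also have "\<dots> \<le> pi / 2 * K"
    using grover_angle_le_pi_quarter[OF assms(1)] assms
    by (intro mult_right_mono) (auto simp: K_def)
  finally show ?thesis by (simp add: K_def)
qed

lemma grover_queries_pos:
  assumes "N \<ge> 2" "0 < p" "p \<le> 1"
  shows "grover_queries N p > 0"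
  using one_less_mult_Suc_grover_queries[OF assms(1,2)] assms(3) by (intro Nat.gr0I) auto

lemma power_one_minus_le:
  fixes p :: real
  assumes "0 \<le> p" "p \<le> 1"
  shows "(1 - p) ^ n \<le> 1 / (1 + p * n)"
proof -
  have "(1 - p) ^ n * (1 + p * n) \<le> (1 - p) ^ n * (1 + p) ^ n"
    using Bernoulli_inequality[of p n] assms by (intro mult_left_mono) (auto simp: mult.commute)
  also have "\<dots> = (1 - p\<^sup>2) ^ n"
    by (simp add: power_mult_distrib[symmetric] power2_eq_square algebra_simps)
  also have "\<dots> \<le> 1"
    using assms by (intro power_le_one) (auto simp: power_le_one)
  finally show ?thesis using assms by (simp add: pos_le_divide_eq add_pos_nonneg)
qed

lemma power_one_minus_grover_queries_le:
  assumes "N \<ge> 2" "0 < p" "p \<le> 1"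
  shows "(1 - p) ^ grover_queries N p \<le> 2/3"
proof -
  let ?n = "grover_queries N p"
  have "p * (?n + 1) \<le> p * (2 * ?n)"
    using grover_queries_pos[OF assms] assms by (intro mult_left_mono) auto
  then have "1/2 \<le> p * ?n" using one_less_mult_Suc_grover_queries[OF assms(1,2)] by simp
  then have "1 / (1 + p * ?n) \<le> 1 / (1 + 1/2)" by (intro divide_left_mono) auto
  then show ?thesis using power_one_minus_le[of p ?n] assms by simp
qed

lemma sin_squared_3_grover_angle:
  assumes "N > 0"
  shows "(sin (3 * grover_angle N))\<^sup>2 = (3 - 4 / N)\<^sup>2 / N"
proof -
  define x s where "x = grover_angle N" and "s = sin x"
  have s: "s\<^sup>2 = 1 / N" using assms by (simp add: s_def x_def sin_grover_angle power_divide)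
  have "sin (3 * x) = sin (x + 2 * x)" by simp
  also have "\<dots> = s * (1 - 2 * s\<^sup>2) + 2 * s * (cos x)\<^sup>2"
    unfolding sin_add sin_double cos_double_sin by (simp add: s_def power2_eq_square)
  also have "\<dots> = s * (3 - 4 * s\<^sup>2)"
    unfolding cos_squared_eq s_def by (simp add: algebra_simps)
  finally show ?thesis by (simp add: power_mult_distrib s flip: x_def)
qed

lemma search_prob_first_success_ge_quarter:
  assumes N: "2 \<le> N" "N \<le> 12" and i: "i < N" and p: "0 < p" "p \<le> 1"
  shows "1/4 \<le> search_prob p (grover_strategy N {1}) i (grover_queries N p) (uniform_state N) 0"
proof -
  define q where "q = (1 - p) ^ grover_queries N p"
  define s where "s = (3 - 4 / real N)\<^sup>2 / N"
  have "N \<in> {2, 3, 4, 5, 6, 7, 8, 9, 10, 11, 12}" using N by simp presburger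
  then have s: "1 / real N \<le> s" "1/4 \<le> s / 3 + 2 / 3 * (1 / real N)"
    by (auto simp: s_def power2_eq_square)
  have "q * (s - 1 / N) \<le> 2/3 * (s - 1 / N)"
    unfolding q_def using power_one_minus_grover_queries_le[OF N(1) p] s
    by (intro mult_right_mono) auto
  then have "1/4 \<le> (1 - q) * s + q * (1 / N)"
    using s by (simp add: algebra_simps)
  also have "\<dots> = search_prob p (grover_strategy N {1}) i (grover_queries N p) (uniform_state N) 0"
    using N i
    by (simp add: uniform_state_eq_grover_state[of N i] search_prob_first_success
        sin_squared_3_grover_angle sin_grover_angle power_divide q_def s_def del: One_nat_def)
  finally show ?thesis .
qed

lemma grover_angle_le_of_ge_13:
  assumes "N \<ge> 13"
  shows "grover_angle N \<le> 71/250"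
proof (rule grover_angle_le)
  have "1 / sqrt N \<le> 1 / sqrt 13" using assms by (intro divide_left_mono) auto
  also have "\<dots> \<le> 28/100"
    using real_le_rsqrt[of "100/28" 13] by (simp add: power2_eq_square field_simps)
  also have "\<dots> \<le> sin (71/250)"
    using sin_ge_cubic[of "71/250"] by (simp add: power3_eq_cube)
  finally show "1 / sqrt N \<le> sin (71/250)" .
qed (use assms pi_ge_two in auto)

lemma search_prob_every_success_ge_quarter:
  assumes N: "13 \<le> N" and i: "i < N" and p: "0 < p" "p \<le> 1"
  shows "1/4 \<le>
    search_prob p (grover_strategy N {h. odd h}) i (grover_queries N p) (uniform_state N) 0"
proof -
  define \<phi> n where "\<phi> = grover_angle N" and "n = grover_queries N p"
  have \<phi>: "0 < \<phi>" "\<phi> \<le> 71/250"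
    using N grover_angle_pos[of N] grover_angle_le_of_ge_13 by (auto simp: \<phi>_def)
  have mean: "2 * \<phi> * p * n \<le> pi / 2" "pi / 2 < 2 * \<phi> * p * n + 2 * \<phi> * p"
    using grover_queries_bounds[of N p] N p by (simp_all add: \<phi>_def n_def algebra_simps)
  have "\<phi> * p \<le> \<phi>" using \<phi> p by (simp add: mult_left_le)
  then have "\<bar>\<phi> + 2 * \<phi> * p * n - pi / 2\<bar> \<le> \<phi>" using mean by linarith
  then have bias: "(\<phi> + 2 * \<phi> * p * n - pi / 2)\<^sup>2 \<le> \<phi>\<^sup>2"
    using \<phi> by (simp add: abs_le_square_iff[symmetric])
  have "(2 * \<phi>)\<^sup>2 * n * p * (1 - p) = 2 * \<phi> * (2 * \<phi> * p * n) * (1 - p)"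
    by (simp add: power2_eq_square)
  also have "\<dots> \<le> 2 * \<phi> * (2 * \<phi> * p * n)" using \<phi> p by (intro mult_left_le) auto
  also have "\<dots> \<le> 2 * \<phi> * (pi / 2)" using \<phi> mean by (intro mult_left_mono) auto
  finally have variance: "(2 * \<phi>)\<^sup>2 * n * p * (1 - p) \<le> pi * \<phi>" by (simp add: mult.commute)
  have "1/4 \<le> 1/2 + 3/8 - 2/3 * (71/250)\<^sup>2 - 2 * (71/250 :: real)" by (simp add: power2_eq_square)
  also have "\<dots> \<le> 1/2 + pi / 8 - 2 / pi * \<phi>\<^sup>2 - 2 * \<phi>"
    using pi_ge_3 \<phi> by (intro diff_mono add_mono mult_mono power_mono divide_left_mono) auto
  also have "\<dots> = 1/2 + pi / 8 - 2 / pi * (\<phi>\<^sup>2 + pi * \<phi>)" by (simp add: field_simps)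
  also have "\<dots> \<le> 1/2 + pi / 8 -
      2 / pi * ((\<phi> + 2 * \<phi> * p * n - pi / 2)\<^sup>2 + (2 * \<phi>)\<^sup>2 * n * p * (1 - p))"
    using bias variance by (intro diff_left_mono mult_left_mono add_mono) auto
  also have "\<dots> \<le> search_prob p (grover_strategy N {h. odd h}) i n (grover_state N i \<phi>) 0"
    unfolding \<phi>_def using N i p
    by (intro search_prob_every_success_ge sin_squared_ge_quadratic) auto
  also have "grover_state N i \<phi> = uniform_state N"
    using N by (simp add: uniform_state_eq_grover_state[of N i] \<phi>_def)
  finally show ?thesis by (simp add: n_def)
qed

definition noisy_grover_strategy :: "nat \<Rightarrow> nat \<Rightarrow> complex mat" where
  "noisy_grover_strategy N = grover_strategy N (if N \<le> 12 then {1} else {h. odd h})"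

lemma noisy_grover_strategy_unitary: "is_unitary N (noisy_grover_strategy N h)"
  by (simp add: noisy_grover_strategy_def grover_strategy_unitary)

lemma search_prob_noisy_grover_ge_quarter:
  assumes "2 \<le> N" "i < N" "0 < p" "p \<le> 1"
  shows "1/4 \<le> search_prob p (noisy_grover_strategy N) i (grover_queries N p) (uniform_state N) 0"
  using search_prob_first_success_ge_quarter[of N i p] search_prob_every_success_ge_quarter[of N i p] assms
  by (simp add: noisy_grover_strategy_def)

theorem theorem8:
  fixes N :: nat and p :: real and Or :: "nat \<Rightarrow> complex mat"
  assumes "N \<ge> 2" and "0 < p" and "p \<le> 1"
    and "\<forall>i<N. is_unitary (2*N) (Or i)"
    and "\<forall>i<N. \<forall>j<N. Or i *\<^sub>v unit_vec (2*N) (2*j) =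
            (if j = i then -1 else 1) \<cdot>\<^sub>v unit_vec (2*N) (2*j+1)"
  shows "\<exists>(d::nat) Us Uf M.
           d \<ge> 1 \<and>
           length Us = nat \<lfloor>pi / (2 * (2 * arcsin (1 / sqrt (real N))) * p)\<rfloor> \<and>
           (\<forall>U \<in> set Us. is_unitary (2*N*d) U) \<and> is_unitary (2*N*d) Uf \<and>
           is_povm (2*N*d) N M \<and>
           (\<forall>i<N. Re (mtrace (M i * alg_final_state (2*N*d)
                      (tensor_id (2*N) d (oracle_channel p (Or i))) Us Uf)) \<ge> 1/4)"
proof -
  obtain n where n: "grover_queries N p = Suc n"
    using grover_queries_pos[OF assms(1-3)] gr0_conv_Suc by blast
  define d :: nat where "d = 2 ^ n"
  define P W where "P = ampliation N (2*d) (grover_init N)"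
    and "W = feedback_step N d (noisy_grover_strategy N)"
  have "is_unitary (2*N*d) P"
    using ampliation_unitary[OF grover_init_unitary, of N "2*d"] by (simp add: P_def mult_ac)
  moreover have "is_unitary (2*N*d) W"
    unfolding W_def by (intro feedback_step_unitary noisy_grover_strategy_unitary)
  moreover have "is_povm (2*N*d) N (first_proj N (2*d))"
    using first_proj_povm[of N "2*d"] by (simp add: mult_ac)
  moreover have "1/4 \<le> Re (mtrace (first_proj N (2*d) i * alg_final_state (2*N*d)
      (tensor_id (2*N) d (oracle_channel p (Or i))) (P # replicate n W) W))" if i: "i < N" for i
  proof -
    have "phase_oracle N i (Or i)" using assms(4,5) i by (simp add: phase_oracle_def is_unitary_def)
    then show ?thesis
      unfolding P_def W_def using i search_prob_noisy_grover_ge_quarter[OF assms(1) i assms(2,3)]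
      by (subst feedback_search_outcome)
         (simp_all add: is_unitary_carrier noisy_grover_strategy_unitary grover_init_unitary
           grover_init_mult_unit_vec d_def flip: n)
  qed
  moreover have "length (P # replicate n W) = nat \<lfloor>pi / (2 * (2 * arcsin (1 / sqrt (real N))) * p)\<rfloor>"
    using n by (simp add: grover_queries_def grover_angle_def)
  ultimately show ?thesis
    by (intro exI[of _ d] exI[of _ "P # replicate n W"] exI[of _ W] exI[of _ "first_proj N (2*d)"])
       (auto simp: d_def)
qed

end
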